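(* Let $V$, $\phi_k$, $\sigma^\infty$, $E_\infty^l$ and $\operatorname{Dom}E_\infty^l$ be as in the context. Then $E_\infty^l$ has a unique minimiser $\bar\epsilon$ on $\operatorname{Dom}E_\infty^l$. Moreover, $\bar\epsilon$ belongs to the interior (in $\ell^2(\mathbb{N})$) of $\operatorname{Dom}E_\infty^l$.
   Context: $\mathbb{N}=\{1,2,3,\dots\}$ and $\ell^2(\mathbb{N})$ is the space of real square-summable sequences with its usual inner product $(\cdot,\cdot)_{\ell^2(\mathbb{N})}$. **Assumptions on the potential.** $V:\mathbb{R}\to[0,+\infty]$ satisfies: - $V:\mathbb{R}\setminus\{0\}\to(0,+\infty)$ is even and $C^2$; - $V(x)\to V(0)=+\infty$ as $x\downarrow0$ or $x\uparrow 0$; - for each $x\in(0,+\infty)$ there exists $\lambda(x)>0$ such that $\inf_{(0,x)}V''\ge\lambda(x)$; - $V(x),V'(x)\to0$ as $|x|\to\infty$, and there exist $a>\tfrac32$ and constants $c_\delta$ such that for any $\delta>0$, $V''(x)\le c_\delta|x|^{-a-2}$ for all $x\in\mathbb{R}\setminus(-\delta,\delta)$. **Boundary-layer energy.** For $k\ge1$ let $\phi_k(y):=V(k+y)-V(k)-V'(k)y$ (with value $+\infty$ at $y=-k$), and let $\sigma^\infty(i):=\sum_{k=i+1}^\infty(k-i)|V'(k)|$ for $i\ge1$; since $V$ is even, positive and $C^2$ on $\mathbb{R}\setminus\{0\}$, with $V(x)\to V(0)=+\infty$ as $x\to0$, with $\inf_{(0,x)}V''\ge\lambda(x)>0$ for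 every $x>0$, with $V(x),V'(x)\to0$ as $|x|\to\infty$, and with $V''(x)\le c_\delta|x|^{-a-2}$ for all $\delta>0$ and $x\in\mathbb{R}\setminus(-\delta,\delta)$, where $a>\tfrac32$, one has $\sigma^\infty\in\ell^2(\mathbb{N})$ and $\phi_k\ge0$ on $[-k,\infty)$. Set $$\operatorname{Dom}E_\infty^l:=\{\epsilon\in\ell^2(\mathbb{N}):\epsilon(i)\ge-1\ \ \forall i\ge1\},$$ $$E_\infty^l(\epsilon):=\sum_{k=1}^\infty\sum_{j=0}^\infty\phi_k\Big(\sum_{l=j+1}^{k+j}\epsilon(l)\Big)+(\sigma^\infty,\epsilon)_{\ell^2(\mathbb{N})}\in(-\infty,+\infty].$$ *)

theory Defs
  imports "HOL-Analysis.Analysis"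
begin

section \<open>The Hilbert space of square-summable sequences indexed by 1, 2, 3, ...\<close>

text \<open>Sequences are functions on \<^typ>\<open>nat\<close> whose unused coordinate 0 is pinned to 0, so that
  elements correspond bijectively to real square-summable sequences on the positive integers, and
  the sums from 0 below agree with the sums from 1.\<close>

typedef ell2 = "{f :: nat \<Rightarrow> real. f 0 = 0 \<and> summable (\<lambda>i. (f i)\<^sup>2)}"
  morphisms coord Abs_ell2
  by (rule exI[of _ "\<lambda>_. 0"]) simp

setup_lifting type_definition_ell2

lemma coord_0 [simp]: "coord e 0 = 0"
  using coord[of e] by simp

lemma summable_coord_sq: "summable (\<lambda>i. (coord e i)\<^sup>2)"
  using coord[of e] by simp

lemma summable_mult_sq:
  fixes f g :: "nat \<Rightarrow> real"
  assumes "summable (\<lambda>i. (f i)\<^sup>2)" "summable (\<lambda>i. (g i)\<^sup>2)"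
  shows "summable (\<lambda>i. f i * g i)"
proof (rule summable_comparison_test')
  show "summable (\<lambda>i. (f i)\<^sup>2 + (g i)\<^sup>2)"
    using assms by (rule summable_add)
  show "norm (f n * g n) \<le> (f n)\<^sup>2 + (g n)\<^sup>2" for n
  proof -
    have "0 \<le> (\<bar>f n\<bar> - \<bar>g n\<bar>)\<^sup>2" by simp
    then have "2 * (\<bar>f n\<bar> * \<bar>g n\<bar>) \<le> (f n)\<^sup>2 + (g n)\<^sup>2"
      by (simp add: power2_diff)
    moreover have "0 \<le> \<bar>f n\<bar> * \<bar>g n\<bar>" by simp
    ultimately show ?thesis unfolding real_norm_def abs_mult by linarith
  qed
qed

lemma summable_add_sq:
  fixes f g :: "nat \<Rightarrow> real"
  assumes "summable (\<lambda>i. (f i)\<^sup>2)" "summable (\<lambda>i. (g i)\<^sup>2)"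
  shows "summable (\<lambda>i. (f i + g i)\<^sup>2)"
proof -
  have "summable (\<lambda>i. ((f i)\<^sup>2 + (g i)\<^sup>2) + 2 * (f i * g i))"
    by (intro summable_add summable_mult assms summable_mult_sq)
  then show ?thesis by (simp add: power2_sum mult.assoc)
qed

instantiation ell2 :: real_vector
begin

lift_definition zero_ell2 :: ell2 is "\<lambda>_. 0" by simp
lift_definition plus_ell2 :: "ell2 \<Rightarrow> ell2 \<Rightarrow> ell2" is "\<lambda>f g i. f i + g i"
  by (simp add: summable_add_sq)
lift_definition uminus_ell2 :: "ell2 \<Rightarrow> ell2" is "\<lambda>f i. - f i" by simp
lift_definition minus_ell2 :: "ell2 \<Rightarrow> ell2 \<Rightarrow> ell2" is "\<lambda>f g i. f i - g i"
  using summable_add_sq[of _ "\<lambda>i. - g i" for g] by fastforce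
lift_definition scaleR_ell2 :: "real \<Rightarrow> ell2 \<Rightarrow> ell2" is "\<lambda>c f i. c * f i"
  by (simp add: power_mult_distrib summable_mult)

instance
  by standard (transfer; simp add: algebra_simps fun_eq_iff)+

end

instantiation ell2 :: real_inner
begin

lift_definition inner_ell2 :: "ell2 \<Rightarrow> ell2 \<Rightarrow> real" is "\<lambda>f g. \<Sum>i. f i * g i" .

definition norm_ell2 :: "ell2 \<Rightarrow> real" where
  "norm_ell2 x = sqrt (x \<bullet> x)"
definition dist_ell2 :: "ell2 \<Rightarrow> ell2 \<Rightarrow> real" where
  "dist_ell2 x y = norm (x - y)"
definition sgn_ell2 :: "ell2 \<Rightarrow> ell2" where
  "sgn_ell2 x = inverse (norm x) *\<^sub>R x"
definition uniformity_ell2 :: "(ell2 \<times> ell2) filter" where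
  "uniformity_ell2 = (INF e\<in>{0 <..}. principal {(x, y). dist x y < e})"
definition open_ell2 :: "ell2 set \<Rightarrow> bool" where
  "open_ell2 U = (\<forall>x\<in>U. eventually (\<lambda>(x', y). x' = x \<longrightarrow> y \<in> U) uniformity)"

instance
proof
  fix x y z :: ell2 and r :: real
  show "x \<bullet> y = y \<bullet> x"
    by transfer (simp add: mult.commute)
  show "(x + y) \<bullet> z = x \<bullet> z + y \<bullet> z"
    by transfer (simp add: distrib_right suminf_add summable_mult_sq)
  show "(r *\<^sub>R x) \<bullet> y = r * (x \<bullet> y)"
    by transfer (simp add: mult.assoc suminf_mult summable_mult_sq)
  show "0 \<le> x \<bullet> x"
    by transfer (simp add: suminf_nonneg power2_eq_square)
  show "(x \<bullet> x = 0) = (x = 0)"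
    by transfer (auto simp: suminf_eq_zero_iff power2_eq_square fun_eq_iff)
qed (simp_all add: norm_ell2_def dist_ell2_def sgn_ell2_def uniformity_ell2_def open_ell2_def)

end


section \<open>The interaction potential\<close>

definition dV :: "(real \<Rightarrow> ereal) \<Rightarrow> real \<Rightarrow> real" where
  "dV V = deriv (\<lambda>x. real_of_ereal (V x))"

definition d2V :: "(real \<Rightarrow> ereal) \<Rightarrow> real \<Rightarrow> real" where
  "d2V V = deriv (dV V)"

locale potential =
  fixes V :: "real \<Rightarrow> ereal"
  assumes V_pos: "\<And>x. x \<noteq> 0 \<Longrightarrow> 0 < V x \<and> V x < \<infinity>"
    and V_even: "\<And>x. V (- x) = V x"
    and V_C1: "(\<lambda>x. real_of_ereal (V x)) C1_differentiable_on (- {0})"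
    and dV_C1: "dV V C1_differentiable_on (- {0})"
    and V_0: "V 0 = \<infinity>"
    and V_lim_0: "(V \<longlongrightarrow> \<infinity>) (at 0)"
    and V_convex: "\<And>x. 0 < x \<Longrightarrow> \<exists>l>0. ereal l \<le> (INF y\<in>{0<..<x}. ereal (d2V V y))"
    and V_lim_infinity: "(V \<longlongrightarrow> 0) at_infinity"
    and dV_lim_infinity: "(dV V \<longlongrightarrow> 0) at_infinity"
    and d2V_decay: "\<exists>a>3/2. \<exists>c :: real \<Rightarrow> real. \<forall>\<delta>>0. \<forall>x. x \<notin> {-\<delta><..<\<delta>} \<longrightarrow>
        d2V V x \<le> c \<delta> * \<bar>x\<bar> powr (- a - 2)"


section \<open>The boundary-layer energy\<close>

text \<open>Since \<open>V 0 = \<infinity>\<close>, extended-real arithmetic gives \<open>phi V k (- k) = \<infinity>\<close> for \<open>k \<ge> 1\<close>.\<close>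

definition phi :: "(real \<Rightarrow> ereal) \<Rightarrow> nat \<Rightarrow> real \<Rightarrow> ereal" where
  "phi V k y = V (real k + y) - V (real k) - ereal (dV V (real k) * y)"

text \<open>The sum over \<open>k > i\<close> is written with \<open>k = i + m + 1\<close>.\<close>

definition sigma_seq :: "(real \<Rightarrow> ereal) \<Rightarrow> nat \<Rightarrow> real" where
  "sigma_seq V i = (if i = 0 then 0 else \<Sum>m. real (m + 1) * \<bar>dV V (real (i + m + 1))\<bar>)"

definition sigma :: "(real \<Rightarrow> ereal) \<Rightarrow> ell2" where
  "sigma V = Abs_ell2 (sigma_seq V)"

definition Dom_E :: "ell2 set" where
  "Dom_E = {e. \<forall>i\<ge>1. coord e i \<ge> - 1}"

text \<open>The outer index is shifted: the \<open>k\<close>-th term below belongs to \<^term>\<open>phi V (Suc k)\<close>.\<close>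

definition energy :: "(real \<Rightarrow> ereal) \<Rightarrow> ell2 \<Rightarrow> ereal" where
  "energy V e = (\<Sum>k. \<Sum>j. phi V (Suc k) (\<Sum>l=j+1..Suc k + j. coord e l)) + ereal (sigma V \<bullet> e)"


section \<open>Well-definedness\<close>

text \<open>Under the standing assumptions \<^const>\<open>sigma\<close> has the intended coordinates and all terms of
  the double series are nonnegative on \<^const>\<open>Dom_E\<close>.\<close>

lemma C1_differentiable_on_real_deriv:
  fixes f :: "real \<Rightarrow> real"
  assumes "f C1_differentiable_on S" "x \<in> S"
  shows "(f has_real_derivative deriv f x) (at x)"
  using assms unfolding C1_differentiable_on_def
  by (metis DERIV_imp_deriv has_real_derivative_iff_has_vector_derivative)

context potential
begin

lemma DERIV_V: "x \<noteq> 0 \<Longrightarrow> ((\<lambda>x. real_of_ereal (V x)) has_real_derivative dV V x) (at x)"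
  unfolding dV_def by (rule C1_differentiable_on_real_deriv[OF V_C1]) simp

lemma DERIV_dV: "x \<noteq> 0 \<Longrightarrow> (dV V has_real_derivative d2V V x) (at x)"
  unfolding d2V_def by (rule C1_differentiable_on_real_deriv[OF dV_C1]) simp

lemma V_ereal: "x \<noteq> 0 \<Longrightarrow> V x = ereal (real_of_ereal (V x))"
  using V_pos[of x] by (cases "V x") auto

lemma d2V_pos: assumes "0 < x" shows "0 < d2V V x"
proof -
  obtain l where "l > 0" "ereal l \<le> (INF y\<in>{0<..<x+1}. ereal (d2V V y))"
    using V_convex[of "x+1"] assms by auto
  then have "ereal l \<le> ereal (d2V V x)"
    using assms by (auto simp: le_INF_iff)
  with \<open>l > 0\<close> show ?thesis by simp
qed

lemma dV_lim_at_top: "(dV V \<longlongrightarrow> 0) at_top"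
  using dV_lim_infinity at_top_le_at_infinity tendsto_mono by blast

lemma dV_nonpos: assumes "0 < x" shows "dV V x \<le> 0"
proof (rule tendsto_lowerbound[OF dV_lim_at_top])
  show "\<forall>\<^sub>F y in at_top. dV V x \<le> dV V y"
    using eventually_ge_at_top[of x]
  proof eventually_elim
    case (elim y)
    show ?case
    proof (rule DERIV_nonneg_imp_nondecreasing[OF elim])
      fix z assume "x \<le> z" "z \<le> y"
      then show "\<exists>d. (dV V has_real_derivative d) (at z) \<and> 0 \<le> d"
        using assms DERIV_dV[of z] d2V_pos[of z] by (intro exI[of _ "d2V V z"]) auto
    qed
  qed
qed simp

lemma dV_bound:
  obtains a C where "a > 3/2" "0 \<le> C" "\<And>x. 1 \<le> x \<Longrightarrow> \<bar>dV V x\<bar> \<le> C * x powr (- a - 1)"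
proof -
  obtain a and c :: "real \<Rightarrow> real" where a: "a > 3/2"
    and c: "\<And>\<delta> x. \<delta> > 0 \<Longrightarrow> x \<notin> {-\<delta><..<\<delta>} \<Longrightarrow> d2V V x \<le> c \<delta> * \<bar>x\<bar> powr (- a - 2)"
    using d2V_decay by blast
  define C where "C = c 1 / (a + 1)"
  have c1: "d2V V x \<le> c 1 * x powr (- a - 2)" if "1 \<le> x" for x
    using c[of 1 x] that by simp
  have "0 < c 1" using c1[of 1] d2V_pos[of 1] by simp
  then have C: "0 \<le> C" using a by (simp add: C_def)
  let ?g = "\<lambda>x. dV V x + C * x powr (- a - 1)"
  have lim: "(?g \<longlongrightarrow> 0 + C * 0) at_top"
    using a by (intro tendsto_intros dV_lim_at_top tendsto_neg_powr) (auto simp: filterlim_ident)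
  have "0 \<le> ?g x" if x: "1 \<le> x" for x
  proof (rule tendsto_upperbound)
    show "(?g \<longlongrightarrow> 0) at_top" using lim by simp
    show "\<forall>\<^sub>F y in at_top. ?g y \<le> ?g x"
      using eventually_ge_at_top[of x]
    proof eventually_elim
      case (elim y)
      show ?case
      proof (rule DERIV_nonpos_imp_nonincreasing[OF elim])
        fix z assume "x \<le> z" "z \<le> y"
        then have z: "1 \<le> z" using x by simp
        have "(?g has_real_derivative d2V V z + C * ((- a - 1) * z powr (- a - 1 - 1))) (at z)"
          using z by (intro DERIV_add DERIV_dV DERIV_cmult has_real_derivative_powr) auto
        moreover have "C * ((- a - 1) * z powr (- a - 1 - 1)) = - (c 1 * z powr (- a - 2))"
          using a by (simp add: C_def field_simps)
        ultimately show "\<exists>d. (?g has_real_derivative d) (at z) \<and> d \<le> 0"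
          using c1[OF z] by (intro exI) auto
      qed
    qed
  qed simp
  then have "\<bar>dV V x\<bar> \<le> C * x powr (- a - 1)" if "1 \<le> x" for x
    using that dV_nonpos[of x] by fastforce
  with a C show ?thesis using that by blast
qed

lemma powr_tail:
  fixes a :: real
  assumes a: "a > 1" and n: "n > 0"
  shows "summable (\<lambda>m. real (n + m + 1) powr (- a))"
    and "(\<Sum>m. real (n + m + 1) powr (- a)) \<le> real n powr (1 - a) / (a - 1)"
proof -
  let ?F = "\<lambda>m. real (n + m) powr (1 - a) / (a - 1)"
  have le: "real (n + m + 1) powr (- a) \<le> ?F m - ?F (Suc m)" for m
  proof -
    let ?h = "\<lambda>x::real. x powr (1 - a) / (a - 1)"
    have "\<exists>z. real (n + m) < z \<and> z < real (n + m + 1) \<and>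
        ?h (real (n + m + 1)) - ?h (real (n + m))
          = (real (n + m + 1) - real (n + m)) * (- (z powr (- a)))"
    proof (rule MVT2)
      fix x :: real assume "real (n + m) \<le> x" "x \<le> real (n + m + 1)"
      then have "0 < x" using n by linarith
      then have "(?h has_real_derivative ((1 - a) * x powr (1 - a - 1)) / (a - 1)) (at x)"
        by (intro DERIV_cdivide has_real_derivative_powr)
      moreover have "((1 - a) * x powr (1 - a - 1)) / (a - 1) = - (x powr (- a))"
        using a by (simp add: field_simps)
      ultimately show "(?h has_real_derivative - (x powr (- a))) (at x)" by simp
    qed simp
    then obtain z where z: "real (n + m) < z" "z < real (n + m + 1)"
      "?h (real (n + m + 1)) - ?h (real (n + m)) = - (z powr (- a))" by auto
    have "real (n + m + 1) powr (- a) \<le> z powr (- a)"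
      using z a n by (intro powr_mono2') auto
    with z(3) show ?thesis by (simp add: add_ac)
  qed
  have "filterlim (\<lambda>m. real (n + m)) at_top sequentially"
    by (intro filterlim_compose[OF filterlim_real_sequentially] filterlim_subseq)
       (auto simp: strict_mono_def)
  then have "(\<lambda>m. real (n + m) powr (1 - a)) \<longlonglongrightarrow> 0"
    using a by (intro tendsto_neg_powr) auto
  then have "?F \<longlonglongrightarrow> 0 / (a - 1)"
    using a by (intro tendsto_divide tendsto_const) auto
  then have "(\<lambda>m. ?F m - ?F (Suc m)) sums (?F 0 - 0)"
    by (intro telescope_sums') simp
  then have s: "(\<lambda>m. ?F m - ?F (Suc m)) sums (real n powr (1 - a) / (a - 1))" by simp
  show sm: "summable (\<lambda>m. real (n + m + 1) powr (- a))"
    by (rule summable_comparison_test'[OF sums_summable[OF s]]) (use le in simp)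
  show "(\<Sum>m. real (n + m + 1) powr (- a)) \<le> real n powr (1 - a) / (a - 1)"
    using suminf_le[OF le sm sums_summable[OF s]] sums_unique[OF s] by simp
qed

lemma sigma_seq_bound:
  "\<exists>a>3/2. \<exists>C\<ge>0. \<forall>i>0. summable (\<lambda>m. real (m + 1) * \<bar>dV V (real (i + m + 1))\<bar>) \<and>
     0 \<le> sigma_seq V i \<and> sigma_seq V i \<le> C * real i powr (1 - a)"
proof -
  obtain a C where a: "a > 3/2" and C: "0 \<le> C"
    and b: "\<And>x. 1 \<le> x \<Longrightarrow> \<bar>dV V x\<bar> \<le> C * x powr (- a - 1)"
    using dV_bound by blast
  have le: "real (m + 1) * \<bar>dV V (real (i + m + 1))\<bar> \<le> C * real (i + m + 1) powr (- a)" for i m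
  proof -
    let ?x = "real (i + m + 1)"
    have "real (m + 1) * \<bar>dV V ?x\<bar> \<le> ?x * (C * ?x powr (- a - 1))"
      by (intro mult_mono b) auto
    also have "\<dots> = C * (?x powr 1 * ?x powr (- a - 1))" by simp
    also have "?x powr 1 * ?x powr (- a - 1) = ?x powr (- a)"
      by (simp only: powr_add[symmetric]) simp
    finally show ?thesis .
  qed
  have a1: "a > 1" using a by simp
  have sC: "summable (\<lambda>m. C * real (i + m + 1) powr (- a))" if "i > 0" for i
    by (intro summable_mult powr_tail(1) a1 that)
  have sm: "summable (\<lambda>m. real (m + 1) * \<bar>dV V (real (i + m + 1))\<bar>)" if "i > 0" for i
    by (rule summable_comparison_test'[OF sC[OF that]]) (use le in simp)
  have "0 \<le> sigma_seq V i \<and> sigma_seq V i \<le> (C / (a - 1)) * real i powr (1 - a)" if i: "i > 0" for i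
  proof
    have eq: "sigma_seq V i = (\<Sum>m. real (m + 1) * \<bar>dV V (real (i + m + 1))\<bar>)"
      using i by (simp add: sigma_seq_def)
    show "0 \<le> sigma_seq V i"
      unfolding eq by (rule suminf_nonneg[OF sm[OF i]]) simp
    have "sigma_seq V i \<le> (\<Sum>m. C * real (i + m + 1) powr (- a))"
      unfolding eq by (rule suminf_le[OF le sm[OF i] sC[OF i]])
    also have "\<dots> = C * (\<Sum>m. real (i + m + 1) powr (- a))"
      by (rule suminf_mult[OF powr_tail(1)[OF a1 i]])
    also have "\<dots> \<le> C * (real i powr (1 - a) / (a - 1))"
      by (rule mult_left_mono[OF powr_tail(2)[OF a1 i] C])
    finally show "sigma_seq V i \<le> (C / (a - 1)) * real i powr (1 - a)" by simp
  qed
  moreover have "0 \<le> C / (a - 1)" using C a by simp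
  ultimately show ?thesis using a sm by blast
qed

lemma sigma_seq_summable:
  "i > 0 \<Longrightarrow> summable (\<lambda>m. real (m + 1) * \<bar>dV V (real (i + m + 1))\<bar>)"
  using sigma_seq_bound by blast

lemma sigma_seq_ell2: "summable (\<lambda>i. (sigma_seq V i)\<^sup>2)"
proof -
  obtain a C where a: "a > 3/2" and C: "0 \<le> C"
    and b: "\<And>i. i > 0 \<Longrightarrow> 0 \<le> sigma_seq V i \<and> sigma_seq V i \<le> C * real i powr (1 - a)"
    using sigma_seq_bound by blast
  have "summable (\<lambda>i. C\<^sup>2 * real i powr (2 - 2 * a))"
    using a by (intro summable_mult) (simp add: summable_real_powr_iff)
  then show ?thesis
  proof (rule summable_comparison_test')
    fix i :: nat
    show "norm ((sigma_seq V i)\<^sup>2) \<le> C\<^sup>2 * real i powr (2 - 2 * a)"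
    proof (cases "i = 0")
      case True then show ?thesis by (simp add: sigma_seq_def)
    next
      case False
      then have "(sigma_seq V i)\<^sup>2 \<le> (C * real i powr (1 - a))\<^sup>2"
        using b[of i] by (intro power_mono) auto
      also have "\<dots> = C\<^sup>2 * (real i powr (1 - a) * real i powr (1 - a))"
        by (simp add: power2_eq_square)
      also have "real i powr (1 - a) * real i powr (1 - a) = real i powr (2 - 2 * a)"
        by (simp add: powr_add[symmetric])
      finally show ?thesis by simp
    qed
  qed
qed

lemma coord_sigma: "coord (sigma V) = sigma_seq V"
  unfolding sigma_def by (rule Abs_ell2_inverse) (simp add: sigma_seq_ell2, simp add: sigma_seq_def)

lemma phi_minus: "k \<ge> 1 \<Longrightarrow> phi V k (- real k) = \<infinity>"
  using V_ereal[of "real k"] by (cases "V (real k)") (auto simp: phi_def V_0)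

lemma phi_nonneg:
  assumes k: "k \<ge> 1" and y: "y \<ge> - real k"
  shows "0 \<le> phi V k y"
proof (cases "y = - real k")
  case True then show ?thesis using phi_minus[OF k] by simp
next
  case False
  let ?f = "\<lambda>x. real_of_ereal (V x)"
  have pos: "real k + y > 0" "real k > 0" using False y k by auto
  have "convex_on {0<..} ?f"
    using DERIV_V DERIV_dV d2V_pos
    by (intro f''_ge0_imp_convex[where f' = "dV V" and f'' = "d2V V"]) (auto intro: less_imp_le)
  then have "?f (real k + y) - ?f (real k) \<ge> dV V (real k) * ((real k + y) - real k)"
    using pos DERIV_V[of "real k"]
    by (intro convex_on_imp_above_tangent[where A = "{0<..}"])
       (auto simp: interior_open intro: has_field_derivative_at_within)
  moreover have "phi V k y = ereal (?f (real k + y) - ?f (real k) - dV V (real k) * y)"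
    unfolding phi_def using V_ereal[of "real k + y"] V_ereal[of "real k"] pos
    by (metis less_irrefl ereal_minus(1))
  ultimately show ?thesis by simp
qed

lemma energy_terms_nonneg:
  assumes "e \<in> Dom_E"
  shows "0 \<le> phi V (Suc k) (\<Sum>l=j+1..Suc k + j. coord e l)"
proof (rule phi_nonneg)
  have "(\<Sum>l=j+1..Suc k + j. (- 1 :: real)) \<le> (\<Sum>l=j+1..Suc k + j. coord e l)"
    using assms by (intro sum_mono) (auto simp: Dom_E_def)
  then show "- real (Suc k) \<le> (\<Sum>l=j+1..Suc k + j. coord e l)" by simp
qed simp

end

end

theory Submission
  imports Defs
begin

text \<open>On a compact interval \<open>[-1, K]\<close> the function \<open>\<phi>\<^sub>1\<close> is uniformly convex, so on admissible
  sequences with coordinates at most \<open>K\<close> the energy satisfies a midpoint inequality with a gain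
  proportional to \<open>\<parallel>e - f\<parallel>\<^sup>2\<close>. Sublevel sets of the energy lie in such a region: \<open>\<sigma> \<ge> 0\<close>, so
  the linear term only hurts on the negative parts of the coordinates, where \<open>\<phi>\<^sub>1\<close> dominates a
  quadratic, and \<open>\<phi>\<^sub>1\<close> grows at least linearly at infinity. Hence minimising sequences are Cauchy
  in norm and no weak compactness is needed; Fatou's lemma for the double series gives lower
  semicontinuity. A minimiser has finite energy, so none of its coordinates equals \<open>-1\<close>; as they
  tend to \<open>0\<close>, they stay uniformly away from \<open>-1\<close>.\<close>

section \<open>Coordinates and completeness of \<open>ell2\<close>\<close>

lemma summable_coord_mult: "summable (\<lambda>i. coord x i * coord y i)"
  by (simp add: summable_mult_sq summable_coord_sq)

lemma inner_ell2_eq: "x \<bullet> y = (\<Sum>i. coord x i * coord y i)"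
  by transfer simp

lemma norm_ell2_sums: "(\<lambda>i. (coord x i)\<^sup>2) sums (norm x)\<^sup>2"
  unfolding power2_norm_eq_inner inner_ell2_eq
  using summable_sums[OF summable_coord_mult[of x x]] by (simp add: power2_eq_square)

lemma sum_coord_sq_le_norm: "(\<Sum>i<n. (coord x i)\<^sup>2) \<le> (norm x)\<^sup>2"
  using sum_le_suminf[OF summable_coord_sq[of x], of "{..<n}"] sums_unique[OF norm_ell2_sums[of x]]
  by simp

lemma abs_coord_le_norm: "\<bar>coord x i\<bar> \<le> norm x"
proof -
  have "(coord x i)\<^sup>2 \<le> (\<Sum>i<Suc i. (coord x i)\<^sup>2)"
    by (simp add: sum_nonneg)
  also have "\<dots> \<le> (norm x)\<^sup>2"
    by (rule sum_coord_sq_le_norm)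
  finally show ?thesis
    by (simp only: power2_le_iff_abs_le[OF norm_ge_zero])
qed

lemma coord_diff: "coord (x - y) i = coord x i - coord y i"
  by (simp add: minus_ell2.rep_eq)

lemma coord_add: "coord (x + y) i = coord x i + coord y i"
  by (simp add: plus_ell2.rep_eq)

lemma coord_scaleR: "coord (c *\<^sub>R x) i = c * coord x i"
  by (simp add: scaleR_ell2.rep_eq)

lemma coord_tendsto_0: "coord x \<longlonglongrightarrow> 0"
proof -
  have "(\<lambda>i. (coord x i)\<^sup>2) \<longlonglongrightarrow> 0"
    by (rule summable_LIMSEQ_zero[OF summable_coord_sq])
  then have "(\<lambda>i. sqrt ((coord x i)\<^sup>2)) \<longlonglongrightarrow> sqrt 0"
    by (rule tendsto_real_sqrt)
  then show ?thesis
    by (simp add: tendsto_rabs_zero_iff)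
qed

lemma tendsto_coord:
  fixes X :: "nat \<Rightarrow> ell2"
  assumes "X \<longlonglongrightarrow> x"
  shows "(\<lambda>n. coord (X n) i) \<longlonglongrightarrow> coord x i"
proof -
  have "(\<lambda>n. norm (X n - x)) \<longlonglongrightarrow> 0"
    using assms LIM_zero tendsto_norm_zero by blast
  then have "(\<lambda>n. coord (X n) i - coord x i) \<longlonglongrightarrow> 0"
    by (rule Lim_null_comparison[rotated]) (use abs_coord_le_norm[of "_ - x" i] in \<open>simp add: coord_diff\<close>)
  then show ?thesis
    by (simp add: LIM_zero_iff)
qed

text \<open>Supplies the limits of Cauchy minimising sequences; the limit is built
  coordinatewise.\<close>

instance ell2 :: complete_space
proof
  fix X :: "nat \<Rightarrow> ell2"
  assume X: "Cauchy X"
  have "Cauchy (\<lambda>n. coord (X n) i)" for i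
  proof (rule metric_CauchyI)
    fix e :: real assume "0 < e"
    then obtain M where M: "\<forall>m\<ge>M. \<forall>n\<ge>M. dist (X m) (X n) < e"
      using X metric_CauchyD by blast
    show "\<exists>M. \<forall>m\<ge>M. \<forall>n\<ge>M. dist (coord (X m) i) (coord (X n) i) < e"
      using M abs_coord_le_norm[of "X _ - X _" i]
      unfolding dist_norm coord_diff real_norm_def by (meson le_less_trans)
  qed
  then have "\<exists>l. (\<lambda>n. coord (X n) i) \<longlonglongrightarrow> l" for i
    by (simp add: Cauchy_convergent_iff convergent_def)
  then obtain g where g: "\<And>i. (\<lambda>n. coord (X n) i) \<longlonglongrightarrow> g i"
    by metis
  have g0: "g 0 = 0"
    using g[of 0] by (simp add: LIMSEQ_const_iff)
  \<comment> \<open>Finite sums are used because \<open>X m - g\<close> is not yet known to be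
    square-summable; for each \<open>k\<close> the Cauchy bound survives the limit in
    \<open>n\<close>.\<close>
  have tail: "\<exists>M. \<forall>m\<ge>M. \<forall>k. (\<Sum>i<k. (coord (X m) i - g i)\<^sup>2) \<le> e\<^sup>2" if e: "0 < e" for e
  proof -
    obtain M where M: "\<forall>m\<ge>M. \<forall>n\<ge>M. dist (X m) (X n) < e"
      using X e metric_CauchyD by blast
    have "(\<Sum>i<k. (coord (X m) i - g i)\<^sup>2) \<le> e\<^sup>2" if m: "m \<ge> M" for m k
    proof (rule tendsto_upperbound)
      show "(\<lambda>n. \<Sum>i<k. (coord (X m) i - coord (X n) i)\<^sup>2)
          \<longlonglongrightarrow> (\<Sum>i<k. (coord (X m) i - g i)\<^sup>2)"
        by (intro tendsto_intros g)
      show "\<forall>\<^sub>F n in sequentially. (\<Sum>i<k. (coord (X m) i - coord (X n) i)\<^sup>2) \<le> e\<^sup>2"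
        using eventually_ge_at_top[of M]
      proof eventually_elim
        case (elim n)
        have "(\<Sum>i<k. (coord (X m) i - coord (X n) i)\<^sup>2) \<le> (norm (X m - X n))\<^sup>2"
          using sum_coord_sq_le_norm[of "X m - X n" k] by (simp add: coord_diff)
        also have "\<dots> \<le> e\<^sup>2"
          using M m elim by (intro power_mono) (auto simp: dist_norm less_imp_le)
        finally show ?case .
      qed
    qed simp
    then show ?thesis by blast
  qed
  have summ: "summable (\<lambda>i. (coord (X m) i - g i)\<^sup>2)"
    if "\<forall>k. (\<Sum>i<k. (coord (X m) i - g i)\<^sup>2) \<le> e\<^sup>2" for m e
    using that by (intro summableI_nonneg_bounded[where x="e\<^sup>2"]) auto
  obtain M where "\<forall>m\<ge>M. \<forall>k. (\<Sum>i<k. (coord (X m) i - g i)\<^sup>2) \<le> 1\<^sup>2"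
    using tail[of 1] by auto
  then have "summable (\<lambda>i. (coord (X M) i - g i)\<^sup>2)"
    using summ[of M 1] by auto
  \<comment> \<open>Recovers \<open>g\<close> as \<open>X M - (X M - g)\<close>, a difference of
    square-summable sequences.\<close>
  then have "summable (\<lambda>i. (coord (X M) i + - (coord (X M) i - g i))\<^sup>2)"
    by (intro summable_add_sq[OF summable_coord_sq]) (simp add: power2_commute)
  then have cL: "coord (Abs_ell2 g) = g"
    by (intro Abs_ell2_inverse) (simp add: g0)
  have "X \<longlonglongrightarrow> Abs_ell2 g"
  proof (rule metric_LIMSEQ_I)
    fix r :: real assume r: "0 < r"
    obtain M where M: "\<forall>m\<ge>M. \<forall>k. (\<Sum>i<k. (coord (X m) i - g i)\<^sup>2) \<le> (r/2)\<^sup>2"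
      using tail[of "r/2"] r by auto
    have "dist (X m) (Abs_ell2 g) < r" if m: "m \<ge> M" for m
    proof -
      have "(norm (X m - Abs_ell2 g))\<^sup>2 = (\<Sum>i. (coord (X m) i - g i)\<^sup>2)"
        using sums_unique[OF norm_ell2_sums] by (simp add: coord_diff cL)
      also have "\<dots> \<le> (r/2)\<^sup>2"
        using M m by (intro suminf_le_const summ) auto
      finally show ?thesis
        using r by (simp add: dist_norm power2_le_iff_abs_le)
    qed
    then show "\<exists>M. \<forall>m\<ge>M. dist (X m) (Abs_ell2 g) < r" by blast
  qed
  then show "convergent X" by (auto simp: convergent_def)
qed

section \<open>Fatou's lemma for series and the geometry of \<open>Dom_E\<close>\<close>

text \<open>Superadditivity of liminf, valid here because nonnegativity excludes opposite
  infinities, handles finite sums; the series is their supremum.\<close>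

lemma suminf_liminf_le:
  fixes g :: "nat \<Rightarrow> nat \<Rightarrow> ereal"
  assumes nonneg: "\<And>n i. 0 \<le> g n i" "\<And>i. 0 \<le> f i"
    and le: "\<And>i. f i \<le> liminf (\<lambda>n. g n i)"
  shows "(\<Sum>i. f i) \<le> liminf (\<lambda>n. \<Sum>i. g n i)"
proof (rule suminf_bound, rule allI)
  fix N
  have "(\<Sum>i<N. f i) \<le> liminf (\<lambda>n. \<Sum>i<N. g n i)"
  proof (induction N)
    case 0
    then show ?case by (simp add: Liminf_const)
  next
    case (Suc N)
    have nn: "0 \<le> liminf (\<lambda>n. \<Sum>i<N. g n i)" "0 \<le> liminf (\<lambda>n. g n N)"
      by (auto intro!: Liminf_bounded always_eventually sum_nonneg nonneg)
    have "(\<Sum>i<Suc N. f i) \<le> liminf (\<lambda>n. \<Sum>i<N. g n i) + liminf (\<lambda>n. g n N)"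
      using Suc le by (simp add: add_mono)
    also have "\<dots> \<le> liminf (\<lambda>n. (\<Sum>i<N. g n i) + g n N)"
      using nn by (intro ereal_liminf_add_mono) auto
    finally show ?case by simp
  qed
  also have "\<dots> \<le> liminf (\<lambda>n. \<Sum>i. g n i)"
    by (intro Liminf_mono always_eventually allI suminf_upper nonneg)
  finally show "(\<Sum>i<N. f i) \<le> liminf (\<lambda>n. \<Sum>i. g n i)" .
qed (rule nonneg)

lemma Dom_E_midpoint:
  assumes "e \<in> Dom_E" "f \<in> Dom_E"
  shows "(1/2) *\<^sub>R (e + f) \<in> Dom_E"
  using assms by (fastforce simp: Dom_E_def coord_scaleR coord_add)

lemma interior_Dom_E:
  assumes e: "\<And>i. - 1 < coord e i"
  shows "e \<in> interior Dom_E"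
proof -
  have "\<forall>\<^sub>F i in sequentially. - 1/2 < coord e i"
    by (rule order_tendstoD(1)[OF coord_tendsto_0]) simp
  then obtain N where N: "\<And>i. N \<le> i \<Longrightarrow> - 1/2 < coord e i"
    by (auto simp: eventually_sequentially)
  \<comment> \<open>The entry \<open>1/2\<close> covers the tail and keeps the set nonempty when
    \<open>N = 0\<close>.\<close>
  define r where "r = Min (insert (1/2) ((\<lambda>i. coord e i + 1) ` {..<N}))"
  have r: "0 < r"
  proof -
    have "0 < coord e i + 1" for i using e[of i] by linarith
    then show ?thesis by (auto simp: r_def)
  qed
  have le: "r - 1 \<le> coord e i" for i
  proof (cases "i < N")
    case True
    then have "r \<le> coord e i + 1"
      unfolding r_def by (intro Min_le) auto
    then show ?thesis by simp
  next
    case False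
    have "r \<le> 1/2" unfolding r_def by (intro Min_le) auto
    then show ?thesis using N[of i] False by simp
  qed
  have "ball e r \<subseteq> Dom_E"
  proof
    fix f assume "f \<in> ball e r"
    then have "\<bar>coord e i - coord f i\<bar> < r" for i
      using abs_coord_le_norm[of "e - f" i] by (simp add: dist_norm coord_diff)
    then show "f \<in> Dom_E"
      unfolding Dom_E_def using le by (smt (verit, best) mem_Collect_eq)
  qed
  then show ?thesis
    using r by (meson centre_in_ball interiorI open_ball)
qed

section \<open>The interaction energy and the pair terms \<open>phi\<close>\<close>

text \<open>Splits off the part that may be infinite but is nonnegative on \<open>Dom_E\<close>; the
  linear part is always finite.\<close>

definition interaction :: "(real \<Rightarrow> ereal) \<Rightarrow> ell2 \<Rightarrow> ereal" where
  "interaction V e = (\<Sum>k. \<Sum>j. phi V (Suc k) (\<Sum>l=j+1..Suc k + j. coord e l))"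

lemma energy_eq: "energy V e = interaction V e + ereal (sigma V \<bullet> e)"
  by (simp add: energy_def interaction_def)

context potential
begin

text \<open>Continuity is meant in \<open>ereal\<close>: at 0 it is the blow-up of \<open>V\<close>.
  It makes \<open>phi V k\<close> continuous even at the singular endpoint
  \<open>-k\<close>.\<close>

lemma isCont_V: "isCont V x"
proof (cases "x = 0")
  case True
  then show ?thesis using V_lim_0 by (simp add: isCont_def V_0)
next
  case False
  have "((\<lambda>y. ereal (real_of_ereal (V y))) \<longlongrightarrow> V x) (at x)"
    using DERIV_isCont[OF DERIV_V[OF False]] V_ereal[OF False]
    by (metis isCont_def lim_ereal)
  then show ?thesis
    unfolding isCont_def
    by (rule Lim_transform_within_open[where s = "- {0}"]) (use False V_ereal in \<open>auto\<close>)
qed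

lemma phi_tendsto:
  assumes "k \<ge> 1" "(y \<longlongrightarrow> l) F"
  shows "((\<lambda>n. phi V k (y n)) \<longlongrightarrow> phi V k l) F"
proof -
  have fin: "\<bar>V (real k)\<bar> \<noteq> \<infinity>"
    using V_pos[of "real k"] assms(1) by auto
  have "((\<lambda>n. V (real k + y n)) \<longlongrightarrow> V (real k + l)) F"
    by (intro isCont_tendsto_compose[OF isCont_V] tendsto_intros assms)
  moreover have "((\<lambda>n. ereal (dV V (real k) * y n)) \<longlongrightarrow> ereal (dV V (real k) * l)) F"
    by (intro tendsto_intros assms)
  ultimately show ?thesis
    unfolding phi_def using fin by (intro tendsto_diff_ereal_general tendsto_const) auto
qed

lemma phi_ereal:
  assumes "k \<ge> 1" "- real k < y"
  shows "phi V k y =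
    ereal (real_of_ereal (V (real k + y)) - real_of_ereal (V (real k)) - dV V (real k) * y)"
proof -
  have "real k + y \<noteq> 0" "real k \<noteq> 0" using assms by auto
  then show ?thesis
    unfolding phi_def using V_ereal by (metis ereal_minus(1))
qed

lemma phi_0: "k \<ge> 1 \<Longrightarrow> phi V k 0 = 0"
  by (simp add: phi_ereal)

text \<open>On a bounded range \<open>V''\<close> is at least some \<open>l > 0\<close>, so
  \<open>V\<close> minus \<open>l / 2 * t\<^sup>2\<close> is still convex, and the affine part of
  \<open>phi\<close> agrees on both sides. The doubled form avoids halving and subtraction in
  \<open>ereal\<close>.\<close>

lemma phi_midpoint_strong:
  assumes k: "k \<ge> 1"
  shows "\<exists>l>0. \<forall>y z. - real k \<le> y \<and> y \<le> K \<and> - real k \<le> z \<and> z \<le> K \<longrightarrow>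
    phi V k ((y + z) / 2) + phi V k ((y + z) / 2) + ereal (l * (y - z)\<^sup>2) \<le> phi V k y + phi V k z"
proof -
  \<comment> \<open>Places \<open>k + y\<close> in \<open>(0, x)\<close> whenever
    \<open>-k < y \<le> K\<close>; the \<open>max\<close> keeps \<open>x\<close> positive for
    negative \<open>K\<close>.\<close>
  define x where "x = real k + max K 0 + 1"
  have "x > 0" by (simp add: x_def add_nonneg_pos)
  then obtain l where l: "l > 0" "ereal l \<le> (INF y\<in>{0<..<x}. ereal (d2V V y))"
    using V_convex by blast
  have ld: "l \<le> d2V V t" if "t \<in> {0<..<x}" for t
    using l(2) that by (auto simp: le_INF_iff)
  let ?f = "\<lambda>t. real_of_ereal (V t)"
  define h where "h = (\<lambda>t. ?f t - l / 2 * t\<^sup>2)"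
  have conv: "convex_on {0<..<x} h"
  proof (rule f''_ge0_imp_convex)
    fix t assume t: "t \<in> {0<..<x}"
    show "(h has_real_derivative (dV V t - l * t)) (at t)"
      unfolding h_def using t by (auto intro!: derivative_eq_intros DERIV_V)
    show "((\<lambda>t. dV V t - l * t) has_real_derivative (d2V V t - l)) (at t)"
      using t by (auto intro!: derivative_eq_intros DERIV_dV)
    show "0 \<le> d2V V t - l" using ld t by simp
  qed simp
  have "phi V k ((y + z) / 2) + phi V k ((y + z) / 2) + ereal (l / 4 * (y - z)\<^sup>2)
      \<le> phi V k y + phi V k z"
    if yz: "- real k \<le> y" "y \<le> K" "- real k \<le> z" "z \<le> K" for y z
  proof (cases "y = - real k \<or> z = - real k")
    \<comment> \<open>One argument is at the singularity, so the right-hand side is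
      infinite.\<close>
    case True
    then show ?thesis
      using phi_minus[OF k] phi_nonneg[OF k yz(1)] phi_nonneg[OF k yz(3)] by auto
  next
    case False
    then have yz': "- real k < y" "- real k < z" using yz by auto
    then have m: "- real k < (y + z) / 2" by simp
    define u v where "u = real k + y" and "v = real k + z"
    have uv: "u \<in> {0<..<x}" "v \<in> {0<..<x}"
      using yz yz' by (auto simp: u_def v_def x_def)
    have "h ((1 - 1/2) *\<^sub>R u + (1/2) *\<^sub>R v) \<le> (1 - 1/2) * h u + (1/2) * h v"
      by (rule convex_onD[OF conv]) (use uv in auto)
    moreover have "(1 - 1/2) *\<^sub>R u + (1/2) *\<^sub>R v = real k + (y + z) / 2"
      by (simp add: u_def v_def field_simps)
    ultimately have "2 * h (real k + (y + z) / 2) \<le> h u + h v" by simp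
    \<comment> \<open>Parallelogram identity, the source of the constant
      \<open>l / 4\<close>.\<close>
    moreover have "2 * (l / 2 * (real k + (y + z) / 2)\<^sup>2) + l / 4 * (y - z)\<^sup>2 = l / 2 * u\<^sup>2 + l / 2 * v\<^sup>2"
      by (simp add: u_def v_def power2_eq_square field_simps)
    ultimately have "2 * ?f (real k + (y + z) / 2) + l / 4 * (y - z)\<^sup>2 \<le> ?f u + ?f v"
      unfolding h_def by argo
    then show ?thesis
      unfolding phi_ereal[OF k m] phi_ereal[OF k yz'(1)] phi_ereal[OF k yz'(2)]
      by (simp add: u_def v_def field_simps)
  qed
  then show ?thesis
    using l(1) by (intro exI[of _ "l/4"]) auto
qed

text \<open>The choice \<open>K = max y z\<close> admits any two points of
  \<open>[-k, \<infinity>)\<close>; the gain is then discarded.\<close>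

lemma phi_midpoint:
  assumes k: "k \<ge> 1" and yz: "- real k \<le> y" "- real k \<le> z"
  shows "phi V k ((y + z) / 2) + phi V k ((y + z) / 2) \<le> phi V k y + phi V k z"
proof -
  obtain l where l: "l > 0"
    "phi V k ((y + z) / 2) + phi V k ((y + z) / 2) + ereal (l * (y - z)\<^sup>2) \<le> phi V k y + phi V k z"
    using phi_midpoint_strong[OF k, of "max y z"] yz by fastforce
  have "phi V k ((y + z) / 2) + phi V k ((y + z) / 2)
      \<le> phi V k ((y + z) / 2) + phi V k ((y + z) / 2) + ereal (l * (y - z)\<^sup>2)"
    using l(1) by (intro ereal_le_add_self) simp
  with l(2) show ?thesis by order
qed

lemma phi_1_lower:
  "\<exists>c>0. \<forall>y. - 1 \<le> y \<and> y \<le> 0 \<longrightarrow> ereal (c * y\<^sup>2) \<le> phi V 1 y"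
proof -
  obtain c where c: "c > 0" and le: "\<And>y z. - 1 \<le> y \<Longrightarrow> y \<le> 0 \<Longrightarrow> - 1 \<le> z \<Longrightarrow> z \<le> 0 \<Longrightarrow>
    phi V 1 ((y + z) / 2) + phi V 1 ((y + z) / 2) + ereal (c * (y - z)\<^sup>2) \<le> phi V 1 y + phi V 1 z"
    using phi_midpoint_strong[of 1 0] by auto
  have "ereal (c * y\<^sup>2) \<le> phi V 1 y" if y: "- 1 \<le> y" "y \<le> 0" for y
  proof -
    have "0 \<le> phi V 1 (y / 2)" using y by (intro phi_nonneg) auto
    then have "ereal (c * y\<^sup>2) \<le> phi V 1 (y / 2) + phi V 1 (y / 2) + ereal (c * y\<^sup>2)"
      using add_nonneg_nonneg add_increasing by blast
    also have "\<dots> \<le> phi V 1 y" using le[of y 0] y phi_0[of 1] by simp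
    finally show ?thesis .
  qed
  with c show ?thesis by auto
qed

text \<open>For \<open>y > 0\<close>, positivity of \<open>V\<close> leaves an affine lower bound of
  slope \<open>- dV V 1 > 0\<close>.\<close>

lemma phi_1_sublevel:
  "\<exists>K\<ge>0. \<forall>y. phi V 1 y \<le> ereal M \<longrightarrow> y \<le> K"
proof -
  \<comment> \<open>Strict monotonicity up to 2 upgrades the weak sign of \<open>dV_nonpos\<close>
    to a strict one at 1.\<close>
  have "dV V 1 < dV V 2"
    by (rule DERIV_pos_imp_increasing) (auto intro!: exI DERIV_dV d2V_pos)
  then have d: "dV V 1 < 0" using dV_nonpos[of 2] by simp
  let ?f = "\<lambda>t. real_of_ereal (V t)"
  have "y \<le> max 0 ((M + ?f 1) / (- dV V 1))" if y: "phi V 1 y \<le> ereal M" for y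
  proof (cases "y > 0")
    case True
    then have "phi V 1 y = ereal (?f (1 + y) - ?f 1 - dV V 1 * y)"
      using phi_ereal[of 1 y] by simp
    moreover have "0 < ?f (1 + y)"
      using V_pos[of "1 + y"] True by (cases "V (1 + y)") auto
    ultimately have "y * (- dV V 1) \<le> M + ?f 1" using y by (simp add: mult.commute)
    then have "y \<le> (M + ?f 1) / (- dV V 1)"
      using d by (subst pos_le_divide_eq) auto
    then show ?thesis by simp
  qed simp
  then show ?thesis by (intro exI[of _ "max 0 ((M + ?f 1) / (- dV V 1))"]) auto
qed

section \<open>Lower bounds and strong midpoint convexity of the interaction\<close>

lemma interaction_nonneg: "e \<in> Dom_E \<Longrightarrow> 0 \<le> interaction V e"
  unfolding interaction_def by (intro suminf_0_le energy_terms_nonneg)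

text \<open>Keeps only the outer term of index 0, whose inner sums consist of one coordinate
  each.\<close>

lemma phi_1_sum_le_interaction:
  assumes "e \<in> Dom_E"
  shows "(\<Sum>j. phi V 1 (coord e (Suc j))) \<le> interaction V e"
  using suminf_upper[of "\<lambda>k. \<Sum>j. phi V (Suc k) (\<Sum>l=j+1..Suc k + j. coord e l)" 1]
    suminf_0_le energy_terms_nonneg[OF assms]
  unfolding interaction_def by simp

lemma phi_1_coord_nonneg:
  assumes "e \<in> Dom_E"
  shows "0 \<le> phi V 1 (coord e (Suc j))"
  using energy_terms_nonneg[OF assms, of 0 j] by simp

lemma phi_1_le_interaction:
  assumes "e \<in> Dom_E"
  shows "phi V 1 (coord e (Suc j)) \<le> interaction V e"
proof -
  have "phi V 1 (coord e (Suc j)) \<le> (\<Sum>i<Suc j. phi V 1 (coord e (Suc i)))"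
    using phi_1_coord_nonneg[OF assms] by (simp add: add_increasing sum_nonneg)
  also have "\<dots> \<le> (\<Sum>j. phi V 1 (coord e (Suc j)))"
    by (intro suminf_upper phi_1_coord_nonneg[OF assms])
  also have "\<dots> \<le> interaction V e"
    by (rule phi_1_sum_le_interaction[OF assms])
  finally show ?thesis .
qed

text \<open>The gain comes from the nearest-neighbour terms, whose arguments are single coordinates,
  so that the squared differences add up to the squared norm; the other terms contribute plain
  convexity.\<close>

lemma interaction_midpoint_strong:
  "\<exists>l>0. \<forall>e f. e \<in> Dom_E \<and> f \<in> Dom_E \<and> (\<forall>i. coord e i \<le> K) \<and> (\<forall>i. coord f i \<le> K) \<longrightarrow>
    interaction V ((1/2) *\<^sub>R (e + f)) + interaction V ((1/2) *\<^sub>R (e + f))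
      + ereal (l * (norm (e - f))\<^sup>2) \<le> interaction V e + interaction V f"
proof -
  obtain l where l: "l > 0" and le: "\<And>y z. - 1 \<le> y \<Longrightarrow> y \<le> K \<Longrightarrow> - 1 \<le> z \<Longrightarrow> z \<le> K \<Longrightarrow>
    phi V 1 ((y + z) / 2) + phi V 1 ((y + z) / 2) + ereal (l * (y - z)\<^sup>2) \<le> phi V 1 y + phi V 1 z"
    using phi_midpoint_strong[of 1 K] by auto
  have "interaction V m + interaction V m + ereal (l * (norm (e - f))\<^sup>2)
      \<le> interaction V e + interaction V f"
    if e: "e \<in> Dom_E" "\<forall>i. coord e i \<le> K" and f: "f \<in> Dom_E" "\<forall>i. coord f i \<le> K"
      and m: "m = (1/2) *\<^sub>R (e + f)" for e f m
  proof -
    define T where "T g k j = phi V (Suc k) (\<Sum>l=j+1..Suc k + j. coord g l)" for g k j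
    \<comment> \<open>The gain as a double series, so that \<open>key\<close> can be summed term by
      term.\<close>
    define Q where "Q k j = (if k = 0 then ereal (l * (coord (e - f) (Suc j))\<^sup>2) else 0)" for k j :: nat
    have mD: "m \<in> Dom_E" using e f m Dom_E_midpoint by simp
    have T0: "0 \<le> T g k j" if "g \<in> Dom_E" for g k j
      unfolding T_def by (rule energy_terms_nonneg[OF that])
    have Q0: "0 \<le> Q k j" for k j using l by (simp add: Q_def)
    have sum_m: "(\<Sum>l=j+1..Suc k + j. coord m l) =
        ((\<Sum>l=j+1..Suc k + j. coord e l) + (\<Sum>l=j+1..Suc k + j. coord f l)) / 2" for k j
      by (simp only: m coord_scaleR coord_add sum.distrib flip: sum_distrib_left)
    have lower: "- real (Suc k) \<le> (\<Sum>l=j+1..Suc k + j. coord g l)" if "g \<in> Dom_E" for g k j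
    proof -
      have "(\<Sum>l=j+1..Suc k + j. (- 1 :: real)) \<le> (\<Sum>l=j+1..Suc k + j. coord g l)"
        using that by (intro sum_mono) (auto simp: Dom_E_def)
      then show ?thesis by simp
    qed
    have key: "T m k j + T m k j + Q k j \<le> T e k j + T f k j" for k j
    proof (cases "k = 0")
      case True
      have mj: "coord m (Suc j) = (coord e (Suc j) + coord f (Suc j)) / 2"
        by (simp add: m coord_scaleR coord_add)
      show ?thesis
        using le[of "coord e (Suc j)" "coord f (Suc j)"] e f True
        by (simp add: T_def Q_def coord_diff Dom_E_def mj)
    next
      case False
      then show ?thesis
        unfolding T_def Q_def sum_m
        using phi_midpoint[OF _ lower[OF e(1)] lower[OF f(1)], of k j j] by simp
    qed
    have SQ: "(\<Sum>k. \<Sum>j. Q k j) = ereal (l * (norm (e - f))\<^sup>2)"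
    proof -
      \<comment> \<open>Shifting the index drops only coordinate 0, which vanishes.\<close>
      have "(\<lambda>j. l * (coord (e - f) (Suc j))\<^sup>2) sums (l * (norm (e - f))\<^sup>2)"
        using norm_ell2_sums[of "e - f"] by (intro sums_mult) (subst sums_Suc_iff, simp)
      then have "(\<Sum>j. ereal (l * (coord (e - f) (Suc j))\<^sup>2)) = ereal (l * (norm (e - f))\<^sup>2)"
        using sums_ereal sums_unique by metis
      then have "(\<Sum>j. Q k j) = (if k = 0 then ereal (l * (norm (e - f))\<^sup>2) else 0)" for k
        by (simp add: Q_def)
      then show ?thesis
        by (simp add: sums_unique[OF sums_single, symmetric])
    qed
    have "(\<Sum>k. \<Sum>j. T m k j) + (\<Sum>k. \<Sum>j. T m k j) + (\<Sum>k. \<Sum>j. Q k j)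
        = (\<Sum>k. \<Sum>j. T m k j + T m k j + Q k j)"
      by (simp add: suminf_add_ereal suminf_0_le T0[OF mD] Q0)
    also have "\<dots> \<le> (\<Sum>k. \<Sum>j. T e k j + T f k j)"
      by (intro suminf_le_pos suminf_0_le key add_nonneg_nonneg T0[OF mD] Q0)
    also have "\<dots> = (\<Sum>k. \<Sum>j. T e k j) + (\<Sum>k. \<Sum>j. T f k j)"
      by (simp add: suminf_add_ereal suminf_0_le T0 e f)
    finally show ?thesis
      unfolding SQ interaction_def T_def .
  qed
  with l show ?thesis by blast
qed

section \<open>Coercivity and the energy gap estimate\<close>

text \<open>By Young's inequality \<open>- 2 * (sigma V \<bullet> e)\<close> is at most
  \<open>C\<close> plus a quadratic in the negative parts, which the interaction dominates. Half of
  the interaction thus absorbs the linear term, whence the factor 2.\<close>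

lemma energy_coercive:
  "\<exists>C. \<forall>e\<in>Dom_E. \<forall>B. energy V e \<le> ereal B \<longrightarrow> interaction V e \<le> ereal (2 * B + C)"
proof -
  obtain c where c: "c > 0" and le: "\<And>y. - 1 \<le> y \<Longrightarrow> y \<le> 0 \<Longrightarrow> ereal (c * y\<^sup>2) \<le> phi V 1 y"
    using phi_1_lower by blast
  \<comment> \<open>The remainder from completing the square below, summed over all
    coordinates.\<close>
  define C where "C = (norm (sigma V))\<^sup>2 / c"
  have "interaction V e \<le> ereal (2 * B + C)" if e: "e \<in> Dom_E" and B: "energy V e \<le> ereal B" for e B
  proof -
    define n where "n i = min (coord e i) 0" for i
    have n_sq: "summable (\<lambda>i. (n i)\<^sup>2)"
      by (rule summable_comparison_test'[OF summable_coord_sq[of e]])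
         (auto simp: n_def min_def)
    have "ereal (c * (\<Sum>i. (n i)\<^sup>2)) = (\<Sum>j. ereal (c * (n (Suc j))\<^sup>2))"
    proof -
      have "(\<lambda>j. c * (n (Suc j))\<^sup>2) sums (c * (\<Sum>i. (n i)\<^sup>2))"
        using summable_sums[OF n_sq] by (intro sums_mult) (subst sums_Suc_iff, simp add: n_def)
      then show ?thesis using sums_ereal sums_unique by metis
    qed
    also have "\<dots> \<le> (\<Sum>j. phi V 1 (coord e (Suc j)))"
    proof (rule suminf_le_pos)
      fix j
      show "0 \<le> ereal (c * (n (Suc j))\<^sup>2)" using c by simp
      \<comment> \<open>A positive coordinate has negative part 0, so nonnegativity of
        \<open>phi\<close> suffices; \<open>le\<close> handles \<open>[-1, 0]\<close>.\<close>
      show "ereal (c * (n (Suc j))\<^sup>2) \<le> phi V 1 (coord e (Suc j))"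
        using le[of "coord e (Suc j)"] phi_1_coord_nonneg[OF e, of j] e
        by (auto simp: n_def min_def Dom_E_def simp flip: zero_ereal_def)
    qed
    also have "\<dots> \<le> interaction V e"
      by (rule phi_1_sum_le_interaction[OF e])
    finally have N: "ereal (c * (\<Sum>i. (n i)\<^sup>2)) \<le> interaction V e" .
    have "- 2 * (sigma V \<bullet> e) \<le> c * (\<Sum>i. (n i)\<^sup>2) + C"
    proof (rule sums_le)
      show "(\<lambda>i. - 2 * (coord (sigma V) i * coord e i)) sums (- 2 * (sigma V \<bullet> e))"
        unfolding inner_ell2_eq by (intro sums_mult summable_sums summable_coord_mult)
      show "(\<lambda>i. c * (n i)\<^sup>2 + (coord (sigma V) i)\<^sup>2 / c) sums (c * (\<Sum>i. (n i)\<^sup>2) + C)"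
        unfolding C_def
        by (intro sums_add sums_mult sums_divide summable_sums n_sq norm_ell2_sums)
      show "- 2 * (coord (sigma V) i * coord e i) \<le> c * (n i)\<^sup>2 + (coord (sigma V) i)\<^sup>2 / c" for i
      proof -
        define s where "s = coord (sigma V) i"
        have "0 \<le> s" unfolding s_def coord_sigma
          using sigma_seq_bound by (cases "i = 0") (auto simp: sigma_seq_def)
        \<comment> \<open>The sign of \<open>sigma\<close> allows the coordinate to be replaced by
          its negative part.\<close>
        then have "s * n i \<le> s * coord e i"
          by (intro mult_left_mono) (auto simp: n_def)
        moreover have "0 \<le> (c * n i + s)\<^sup>2 / c" using c by simp
        moreover have "(c * n i + s)\<^sup>2 / c = c * (n i)\<^sup>2 + 2 * (s * n i) + s\<^sup>2 / c"
          using c by (simp add: power2_eq_square field_simps)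
        ultimately show ?thesis unfolding s_def by linarith
      qed
    qed
    with N B show ?thesis
      unfolding energy_eq by (cases "interaction V e") auto
  qed
  then show ?thesis by blast
qed

text \<open>Every real \<open>B\<close> above the energy satisfies \<open>0 \<le> 2 * B + C\<close>,
  as the interaction is nonnegative.\<close>

lemma energy_bounded_below: "\<exists>b. \<forall>e\<in>Dom_E. ereal b \<le> energy V e"
proof -
  obtain C where C: "\<And>e B. e \<in> Dom_E \<Longrightarrow> energy V e \<le> ereal B \<Longrightarrow>
      interaction V e \<le> ereal (2 * B + C)"
    using energy_coercive by blast
  have "ereal (- C / 2) \<le> energy V e" if e: "e \<in> Dom_E" for e
  proof (rule ereal_le_real)
    fix B assume "energy V e \<le> ereal B"
    then have "ereal 0 \<le> ereal (2 * B + C)"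
      using C[OF e] interaction_nonneg[OF e] by (metis order_trans zero_ereal_def)
    then show "ereal (- C / 2) \<le> ereal B" by simp
  qed
  then show ?thesis by blast
qed

lemma energy_0: "energy V 0 = 0"
  by (simp add: energy_def zero_ell2.rep_eq phi_0)

text \<open>The midpoint is admissible and has energy at least \<open>m\<close>, so the convexity
  gain must fit into the excess. As \<open>l\<close> is fixed before \<open>e\<close>,
  \<open>f\<close>, \<open>a\<close>, \<open>b\<close>, this serves both minimising sequences and,
  with \<open>a = b = m\<close>, uniqueness.\<close>

lemma norm_diff_le_energy_gap:
  "\<exists>l>0. \<forall>e f a b m. e \<in> Dom_E \<and> f \<in> Dom_E \<and> a \<le> B \<and> b \<le> B \<and>
     energy V e \<le> ereal a \<and> energy V f \<le> ereal b \<and> (\<forall>g\<in>Dom_E. ereal m \<le> energy V g) \<longrightarrow>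
     l * (norm (e - f))\<^sup>2 \<le> a + b - 2 * m"
proof -
  obtain C where C: "\<And>e B. e \<in> Dom_E \<Longrightarrow> energy V e \<le> ereal B \<Longrightarrow>
      interaction V e \<le> ereal (2 * B + C)"
    using energy_coercive by blast
  \<comment> \<open>\<open>K\<close> bounds every coordinate on the sublevel set of
    \<open>B\<close>, so one \<open>l\<close> serves all pairs in it.\<close>
  obtain K where K: "K \<ge> 0" "\<And>y. phi V 1 y \<le> ereal (2 * B + C) \<Longrightarrow> y \<le> K"
    using phi_1_sublevel by blast
  obtain l where l: "l > 0" and mid: "\<And>e f. e \<in> Dom_E \<Longrightarrow> f \<in> Dom_E \<Longrightarrow>
      (\<forall>i. coord e i \<le> K) \<Longrightarrow> (\<forall>i. coord f i \<le> K) \<Longrightarrow>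
      interaction V ((1/2) *\<^sub>R (e + f)) + interaction V ((1/2) *\<^sub>R (e + f))
      + ereal (l * (norm (e - f))\<^sup>2) \<le> interaction V e + interaction V f"
    using interaction_midpoint_strong[of K] by blast
  have coord_le: "coord e i \<le> K" if e: "e \<in> Dom_E" "energy V e \<le> ereal B" for e i
  proof (cases i)
    case 0
    then show ?thesis using K by simp
  next
    case (Suc j)
    then show ?thesis
      using K(2) phi_1_le_interaction[OF e(1), of j] C[OF e] order_trans by blast
  qed
  have "l * (norm (e - f))\<^sup>2 \<le> a + b - 2 * m"
    if e: "e \<in> Dom_E" "energy V e \<le> ereal a" "a \<le> B"
      and f: "f \<in> Dom_E" "energy V f \<le> ereal b" "b \<le> B"
      and m: "\<forall>g\<in>Dom_E. ereal m \<le> energy V g" for e f a b m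
  proof -
    define g where "g = (1/2) *\<^sub>R (e + f)"
    have "energy V e \<le> ereal B" "energy V f \<le> ereal B"
      using e f by (meson ereal_less_eq(3) order_trans)+
    then have "interaction V g + interaction V g + ereal (l * (norm (e - f))\<^sup>2)
        \<le> interaction V e + interaction V f"
      unfolding g_def by (intro mid e f allI coord_le)
    moreover have "g \<in> Dom_E" unfolding g_def by (rule Dom_E_midpoint[OF e(1) f(1)])
    then have "ereal m \<le> interaction V g + ereal (sigma V \<bullet> g)" "0 \<le> interaction V g"
      using m interaction_nonneg by (auto simp: energy_eq)
    \<comment> \<open>The linear term cancels exactly in the midpoint comparison.\<close>
    moreover have "sigma V \<bullet> e + sigma V \<bullet> f = 2 * (sigma V \<bullet> g)"
      by (simp add: g_def inner_add_right)
    ultimately show ?thesis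
      using e(2) f(2) interaction_nonneg[OF e(1)] interaction_nonneg[OF f(1)] unfolding energy_eq
      by (cases "interaction V g"; cases "interaction V e"; cases "interaction V f") auto
  qed
  with l show ?thesis by blast
qed

section \<open>Existence of a minimiser\<close>

text \<open>Fatou's lemma is used for the outer and the inner series; each term depends continuously
  on finitely many coordinates.\<close>

lemma interaction_lsc:
  fixes X :: "nat \<Rightarrow> ell2"
  assumes X: "\<And>n. X n \<in> Dom_E" and x: "x \<in> Dom_E" and lim: "X \<longlonglongrightarrow> x"
  shows "interaction V x \<le> liminf (\<lambda>n. interaction V (X n))"
  unfolding interaction_def
proof (intro suminf_liminf_le suminf_0_le energy_terms_nonneg X x)
  fix k j
  have "(\<lambda>n. phi V (Suc k) (\<Sum>l=j+1..Suc k + j. coord (X n) l))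
      \<longlonglongrightarrow> phi V (Suc k) (\<Sum>l=j+1..Suc k + j. coord x l)"
    by (intro phi_tendsto tendsto_sum tendsto_coord lim) simp
  then show "phi V (Suc k) (\<Sum>l=j+1..Suc k + j. coord x l)
      \<le> liminf (\<lambda>n. phi V (Suc k) (\<Sum>l=j+1..Suc k + j. coord (X n) l))"
    by (simp add: lim_imp_Liminf)
qed

lemma energy_attains_min: "\<exists>e\<in>Dom_E. \<forall>f\<in>Dom_E. energy V e \<le> energy V f"
proof -
  define I where "I = (INF e\<in>Dom_E. energy V e)"
  obtain b where "\<forall>e\<in>Dom_E. ereal b \<le> energy V e"
    using energy_bounded_below by blast
  then have "ereal b \<le> I" by (simp add: I_def le_INF_iff)
  moreover have "I \<le> energy V 0"
    unfolding I_def by (rule INF_lower) (simp add: Dom_E_def zero_ell2.rep_eq)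
  \<comment> \<open>The infimum is finite because the zero sequence has energy 0.\<close>
  ultimately obtain m where m: "I = ereal m"
    using energy_0 by (cases I) auto
  have lower: "\<forall>g\<in>Dom_E. ereal m \<le> energy V g"
    unfolding m[symmetric] I_def by (auto intro: INF_lower)
  have "\<exists>e\<in>Dom_E. energy V e < ereal (m + 1 / real (Suc n))" for n
    using m unfolding I_def by (subst INF_less_iff[symmetric]) simp
  then obtain X where X: "\<And>n. X n \<in> Dom_E" "\<And>n. energy V (X n) < ereal (m + 1 / real (Suc n))"
    by metis
  obtain l where l: "l > 0" and gap: "\<And>e f a b. e \<in> Dom_E \<Longrightarrow> f \<in> Dom_E \<Longrightarrow> a \<le> m + 1 \<Longrightarrow>
     b \<le> m + 1 \<Longrightarrow> energy V e \<le> ereal a \<Longrightarrow> energy V f \<le> ereal b \<Longrightarrow>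
     l * (norm (e - f))\<^sup>2 \<le> a + b - 2 * m"
    using norm_diff_le_energy_gap[of "m + 1"] lower by blast
  have gapX: "l * (norm (X p - X q))\<^sup>2 \<le> 1 / real (Suc p) + 1 / real (Suc q)" for p q
  proof -
    have "l * (norm (X p - X q))\<^sup>2 \<le> (m + 1 / real (Suc p)) + (m + 1 / real (Suc q)) - 2 * m"
      by (intro gap X(1) less_imp_le[OF X(2)]) auto
    then show ?thesis by simp
  qed
  have "Cauchy X"
  proof (rule metric_CauchyI)
    fix r :: real assume r: "0 < r"
    \<comment> \<open>Half of \<open>l * r\<^sup>2\<close> for each of the two reciprocals in
      \<open>gapX\<close>.\<close>
    obtain M where M: "1 / real (Suc M) < l * r\<^sup>2 / 2"
      using nat_approx_posE[of "l * r\<^sup>2 / 2"] l r by auto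
    have "dist (X p) (X q) < r" if "p \<ge> M" "q \<ge> M" for p q
    proof -
      have "1 / real (Suc p) \<le> 1 / real (Suc M)" "1 / real (Suc q) \<le> 1 / real (Suc M)"
        using that by (auto intro!: divide_left_mono)
      then have "l * (norm (X p - X q))\<^sup>2 < l * r\<^sup>2"
        using gapX[of p q] M by linarith
      then have "(norm (X p - X q))\<^sup>2 < r\<^sup>2" using l by simp
      then show ?thesis
        using r power2_less_imp_less[of "norm (X p - X q)" r] by (simp add: dist_norm)
    qed
    then show "\<exists>M. \<forall>p\<ge>M. \<forall>q\<ge>M. dist (X p) (X q) < r" by blast
  qed
  then obtain x where x: "X \<longlonglongrightarrow> x"
    using Cauchy_convergent convergent_def by blast
  have xD: "x \<in> Dom_E"
    unfolding Dom_E_def using X(1)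
    by (auto simp: Dom_E_def intro!: tendsto_lowerbound[OF tendsto_coord[OF x]] always_eventually)
  \<comment> \<open>The linear term is moved to the right, where it converges by continuity of the
    inner product; only the interaction is left for \<open>interaction_lsc\<close>.\<close>
  have "(\<lambda>n. ereal (m + 1 / real (Suc n) - sigma V \<bullet> X n)) \<longlonglongrightarrow> ereal (m + 0 - sigma V \<bullet> x)"
    by (intro tendsto_intros x LIMSEQ_inverse_real_of_nat[unfolded inverse_eq_divide])
  then have "liminf (\<lambda>n. ereal (m + 1 / real (Suc n) - sigma V \<bullet> X n)) = ereal (m - sigma V \<bullet> x)"
    by (simp add: lim_imp_Liminf)
  moreover have "interaction V (X n) \<le> ereal (m + 1 / real (Suc n) - sigma V \<bullet> X n)" for n
    using X(2)[of n] unfolding energy_eq by (cases "interaction V (X n)") auto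
  then have "liminf (\<lambda>n. interaction V (X n)) \<le> liminf (\<lambda>n. ereal (m + 1 / real (Suc n) - sigma V \<bullet> X n))"
    by (intro Liminf_mono always_eventually) simp
  ultimately have "interaction V x \<le> ereal (m - sigma V \<bullet> x)"
    using interaction_lsc[OF X(1) xD x] by order
  then have "energy V x \<le> ereal m"
    unfolding energy_eq by (cases "interaction V x") auto
  then show ?thesis
    using xD lower order_trans by blast
qed

section \<open>Uniqueness and interiority of the minimiser\<close>

lemma energy_min_unique:
  assumes e: "e \<in> Dom_E" "\<forall>g\<in>Dom_E. energy V e \<le> energy V g"
    and f: "f \<in> Dom_E" "\<forall>g\<in>Dom_E. energy V f \<le> energy V g"
  shows "e = f"
proof -
  have "energy V e \<le> energy V 0"
    using e(2) by (simp add: Dom_E_def zero_ell2.rep_eq)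
  moreover have "energy V e \<noteq> - \<infinity>"
    using energy_bounded_below e(1) by fastforce
  ultimately obtain m where m: "energy V e = ereal m"
    using energy_0 by (cases "energy V e") auto
  then have f': "energy V f = ereal m"
    using e f by (metis order_antisym)
  \<comment> \<open>With \<open>B = a = b = m\<close> the gap is zero.\<close>
  obtain l where l: "l > 0" "l * (norm (e - f))\<^sup>2 \<le> m + m - 2 * m"
    using norm_diff_le_energy_gap[of m] e(1,2) f(1) eq_refl[OF m] eq_refl[OF f'] m
    by (metis order_refl)
  then have "(norm (e - f))\<^sup>2 \<le> 0" by (simp add: mult_le_0_iff)
  then show ?thesis by simp
qed

text \<open>A coordinate \<open>-1\<close> would make its nearest-neighbour term infinite; index 0,
  also demanded by \<open>interior_Dom_E\<close>, is the pinned zero.\<close>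

lemma energy_finite_imp_interior:
  assumes e: "e \<in> Dom_E" "energy V e < \<infinity>"
  shows "e \<in> interior Dom_E"
proof (rule interior_Dom_E)
  fix i
  show "- 1 < coord e i"
  proof (cases i)
    case (Suc j)
    have "interaction V e < \<infinity>"
      using e(2) unfolding energy_eq by (cases "interaction V e") auto
    then have "phi V 1 (coord e i) \<noteq> \<infinity>"
      using phi_1_le_interaction[OF e(1), of j] Suc by auto
    then have "coord e i \<noteq> - 1" using phi_minus[of 1] by auto
    moreover have "- 1 \<le> coord e i" using e(1) Suc by (simp add: Dom_E_def)
    ultimately show ?thesis by simp
  qed simp
qed

end

theorem lemma4p5:
  fixes V :: "real \<Rightarrow> ereal"
  assumes "potential V"
  shows "(\<exists>!e. is_arg_min (energy V) (\<lambda>e. e \<in> Dom_E) e) \<and>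
         (\<forall>e. is_arg_min (energy V) (\<lambda>e. e \<in> Dom_E) e \<longrightarrow> e \<in> interior Dom_E)"
proof -
  interpret potential V by fact
  have min_iff: "is_arg_min (energy V) (\<lambda>e. e \<in> Dom_E) e \<longleftrightarrow>
      e \<in> Dom_E \<and> (\<forall>f\<in>Dom_E. energy V e \<le> energy V f)" for e
    by (auto simp: is_arg_min_def not_less)
  \<comment> \<open>Comparison with the zero sequence gives the finiteness that the interior
    criterion demands.\<close>
  have "energy V e < \<infinity>" if "\<forall>f\<in>Dom_E. energy V e \<le> energy V f" for e
  proof -
    have "energy V e \<le> energy V 0"
      using that by (simp add: Dom_E_def zero_ell2.rep_eq)
    then show ?thesis by (auto simp: energy_0)
  qed
  then show ?thesis
    unfolding min_iff
    using energy_attains_min energy_min_unique energy_finite_imp_interior by blast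
qed

end
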